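(* Let $T$ be a tree and let $\ell>3$ be an integer. Then $\chi_s'(T\Box C_{2\ell+1})\le 2\Delta(T)+\left\lceil \frac{\Delta(T)}{\ell}\right\rceil+5$, where $C_{2\ell+1}$ is the cycle of length $2\ell+1$.
   Context: $\Delta(T)$ is the maximum degree of $T$. The Cartesian product $G\Box H$ has vertex set $V(G)\times V(H)$, with $(a,u)\sim(b,v)$ iff either $a=b$ and $uv\in E(H)$, or $u=v$ and $ab\in E(G)$. A strong edge coloring is a proper edge coloring in which every color class is an induced matching; $\chi_s'(G)$ is the minimum number of colors in such a coloring. *)

theory Defs
  imports Complex_Main "Graph_Theory.Graph_Theory"
begin

text \<open>
  A finite simple graph is a \<^locale>\<open>pair_graph\<close>: a finite, loop-free digraph whose arc relation
  is symmetric. An undirected edge \<open>uv\<close> is a pair of opposite arcs, represented as \<open>{u, v}\<close>.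
\<close>

definition edges :: "'a pair_pre_digraph \<Rightarrow> 'a set set" where
  "edges G = {{u, v} | u v. (u, v) \<in> parcs G}"

text \<open>In a symmetric digraph the out-degree of a vertex is its degree.\<close>

definition max_degree :: "'a pair_pre_digraph \<Rightarrow> nat" where
  "max_degree G = Max (out_degree (with_proj G) ` pverts G)"

text \<open>
  The library predicates \<^const>\<open>forest\<close> and \<^const>\<open>tree\<close> forbid all directed cycles. In a symmetric
  digraph every edge yields the directed cycle \<open>u, v, u\<close> of length 2, which is not a cycle of the
  undirected graph, so only cycles of length at least 3 are forbidden here. The library notion of
  connectedness includes that the vertex set is non-empty.
\<close>

definition tree_graph :: "'a pair_pre_digraph \<Rightarrow> bool" where
  "tree_graph G \<longleftrightarrow> pair_graph G \<and> Digraph_Component.connected (with_proj G) \<and>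
     \<not> (\<exists>p. pre_digraph.cycle (with_proj G) p \<and> 3 \<le> length p)"

text \<open>The cycle on \<open>n\<close> vertices, meaningful for \<open>n \<ge> 3\<close>.\<close>

definition cycle_graph :: "nat \<Rightarrow> nat pair_pre_digraph" where
  "cycle_graph n = \<lparr> pverts = {..<n},
     parcs = {(i, j). i < n \<and> j < n \<and> (j = Suc i mod n \<or> i = Suc j mod n)} \<rparr>"

definition cartesian_product ::
  "'a pair_pre_digraph \<Rightarrow> 'b pair_pre_digraph \<Rightarrow> ('a \<times> 'b) pair_pre_digraph"
  (infixl \<open>\<box>\<close> 70) where
  "G \<box> H = \<lparr> pverts = pverts G \<times> pverts H,
     parcs = {((a, u), (b, v)). (a \<in> pverts G \<and> a = b \<and> (u, v) \<in> parcs H) \<or>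
                               (u \<in> pverts H \<and> u = v \<and> (a, b) \<in> parcs G)} \<rparr>"

definition matching :: "'a pair_pre_digraph \<Rightarrow> 'a set set \<Rightarrow> bool" where
  "matching G M \<longleftrightarrow> M \<subseteq> edges G \<and> (\<forall>e\<in>M. \<forall>f\<in>M. e \<noteq> f \<longrightarrow> e \<inter> f = {})"

text \<open>
  A matching is induced if the subgraph induced by the vertices it covers has no further edges.
\<close>

definition induced_matching :: "'a pair_pre_digraph \<Rightarrow> 'a set set \<Rightarrow> bool" where
  "induced_matching G M \<longleftrightarrow> matching G M \<and> (\<forall>e\<in>edges G. e \<subseteq> \<Union>M \<longrightarrow> e \<in> M)"

definition proper_edge_coloring :: "'a pair_pre_digraph \<Rightarrow> ('a set \<Rightarrow> nat) \<Rightarrow> bool" where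
  "proper_edge_coloring G c \<longleftrightarrow>
     (\<forall>e\<in>edges G. \<forall>f\<in>edges G. e \<noteq> f \<and> e \<inter> f \<noteq> {} \<longrightarrow> c e \<noteq> c f)"

definition strong_edge_coloring :: "'a pair_pre_digraph \<Rightarrow> ('a set \<Rightarrow> nat) \<Rightarrow> bool" where
  "strong_edge_coloring G c \<longleftrightarrow> proper_edge_coloring G c \<and>
     (\<forall>k. induced_matching G {e \<in> edges G. c e = k})"

definition strong_chromatic_index :: "'a pair_pre_digraph \<Rightarrow> nat" where
  "strong_chromatic_index G = (LEAST k. \<exists>c. strong_edge_coloring G c \<and> c ` edges G \<subseteq> {..<k})"

lemma edges_altdef: "edges G = (\<lambda>(u, v). {u, v}) ` parcs G"
  by (auto simp: edges_def)

lemma strong_edge_coloring_exists: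
  assumes "pair_graph G"
  shows "\<exists>k c. strong_edge_coloring G c \<and> c ` edges G \<subseteq> {..<k}"
proof -
  interpret pair_graph G by fact
  have "finite (edges G)"
    unfolding edges_altdef using pair_finite_arcs by simp
  then obtain c :: "'a set \<Rightarrow> nat" and k where img: "c ` edges G = {i. i < k}"
    and inj: "inj_on c (edges G)"
    using finite_imp_inj_to_nat_seg[of "edges G"] by metis
  have "induced_matching G {e \<in> edges G. c e = k}" for k
    unfolding induced_matching_def matching_def
  proof (intro conjI ballI impI)
    show "{e \<in> edges G. c e = k} \<subseteq> edges G" by blast
    fix e f assume "e \<in> {e \<in> edges G. c e = k}" "f \<in> {e \<in> edges G. c e = k}" "e \<noteq> f"
    then show "e \<inter> f = {}" using inj_onD[OF inj, of e f] by simp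
  next
    fix e assume e: "e \<in> edges G" "e \<subseteq> \<Union> {e \<in> edges G. c e = k}"
    from e(1) obtain u v where uv: "e = {u, v}" "(u, v) \<in> parcs G"
      unfolding edges_def by blast
    with e(2) obtain f g where f: "f \<in> edges G" "c f = k" "u \<in> f"
      and g: "g \<in> edges G" "c g = k" "v \<in> g"
      by blast
    have "f = g" using inj_onD[OF inj, of f g] f g by simp
    moreover have "u \<noteq> v" using pair_no_loops[OF uv(2)] by simp
    moreover obtain x y where "f = {x, y}" using f(1) unfolding edges_def by blast
    ultimately have "e = f" using f(3) g(3) uv(1) by auto
    with f show "e \<in> {e \<in> edges G. c e = k}" by simp
  qed
  moreover have "proper_edge_coloring G c"
    using inj unfolding proper_edge_coloring_def inj_on_def by blast
  ultimately have "strong_edge_coloring G c" by (simp add: strong_edge_coloring_def)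
  with img show ?thesis by (intro exI[of _ k] exI[of _ c]) (simp add: lessThan_def)
qed

lemma pair_graph_cycle_graph:
  assumes "3 \<le> n"
  shows "pair_graph (cycle_graph n)"
proof
  show "finite (parcs (cycle_graph n))"
    by (rule finite_subset[of _ "{..<n} \<times> {..<n}"]) (auto simp: cycle_graph_def)
  show "fst e \<noteq> snd e" if "e \<in> parcs (cycle_graph n)" for e
    using that assms by (auto simp: cycle_graph_def mod_Suc split: if_splits)
qed (auto simp: cycle_graph_def symmetric_def sym_def)

lemma pair_graph_cartesian_product:
  assumes "pair_graph G" "pair_graph H"
  shows "pair_graph (G \<box> H)"
proof -
  interpret G: pair_graph G by fact
  interpret H: pair_graph H by fact
  show ?thesis
  proof
    have fin: "finite (pverts G \<times> pverts H)"
      using G.pair_finite_verts H.pair_finite_verts by simp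
    then show "finite (pverts (G \<box> H))" by (simp add: cartesian_product_def)
    have "parcs (G \<box> H) \<subseteq> (pverts G \<times> pverts H) \<times> (pverts G \<times> pverts H)"
      by (auto simp: cartesian_product_def dest: G.wellformed' H.wellformed')
    then show "finite (parcs (G \<box> H))" using fin by (meson finite_SigmaI finite_subset)
    show "symmetric (with_proj (G \<box> H))"
      using G.arcs_symmetric H.arcs_symmetric
      by (simp add: symmetric_def sym_def cartesian_product_def) blast
  next
    fix e assume e: "e \<in> parcs (G \<box> H)"
    obtain a u b v where [simp]: "e = ((a, u), (b, v))" by (metis surj_pair)
    consider (left) "a \<in> pverts G" "a = b" "(u, v) \<in> parcs H"
      | (right) "u \<in> pverts H" "u = v" "(a, b) \<in> parcs G"
      using e by (auto simp: cartesian_product_def)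
    then have "a \<in> pverts G \<and> u \<in> pverts H \<and> b \<in> pverts G \<and> v \<in> pverts H \<and> (a, u) \<noteq> (b, v)"
    proof cases
      case left
      then show ?thesis using H.wellformed'[OF left(3)] H.no_loops'[OF left(3)] by simp
    next
      case right
      then show ?thesis using G.wellformed'[OF right(3)] G.no_loops'[OF right(3)] by simp
    qed
    then show "fst e \<in> pverts (G \<box> H)" "snd e \<in> pverts (G \<box> H)" "fst e \<noteq> snd e"
      by (simp_all add: cartesian_product_def)
  qed
qed

end

theory Submission
  imports Defs
begin

text \<open>
  With \<open>D = max_degree T\<close> and \<open>k = \<lceil>D / l\<rceil>\<close>, the edges in the copies of \<open>T\<close> receive
  \<open>2 * D + k\<close> colors, and the edges in the copies of the cycle receive 5 further colors, which
  only depend on the position in the cycle and on the parity of the depth in \<open>T\<close>.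

  For the edges of \<open>T\<close>, split \<open>D\<close> into \<open>k\<close> parts of size \<open>r \<le> l\<close>, each with its own \<open>2 * r + 1\<close>
  colors. An edge of \<open>T\<close> at level \<open>i\<close> is only colored through the image of \<open>i\<close> under a homomorphism
  from the cycle of length \<open>2 * l + 1\<close> to that of length \<open>2 * r + 1\<close>, so it suffices to treat
  \<open>r = l = D\<close>. Number the cycle such that neighbors are \<open>r\<close> or \<open>r + 1\<close> apart. At every vertex \<open>v\<close>
  of \<open>T\<close>, each of the \<open>2 * r + 1\<close> colors is used exactly on an arc of length \<open>r\<close>, with one color for
  every starting point; hence adjacent levels have disjoint color sets. Each edge at \<open>v\<close> follows
  a strand consisting of one full arc, an initial segment of a second arc and a final segment of a
  third one. Going along that edge to \<open>w\<close>, initial segments turn into final ones and vice versa,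
  while every other color has its arc moved to one of the two disjoint arcs. These moves can be
  chosen such that the starting points at \<open>w\<close> are again a permutation, and the strand of the
  edge \<open>vw\<close> extends to a decomposition of all arcs at \<open>w\<close> into strands. So the coloring propagates
  from a root through the whole tree.
\<close>

section \<open>Arcs and strands on a cycle of length $2r+1$\<close>

text \<open>Reduction modulo \<open>2 * r + 1\<close> for arguments from
  \<open>- (2 * r + 1)\<close> to \<open>4 * r + 1\<close>. Cases instead of \<open>mod\<close> keep
  later goals in linear arithmetic.\<close>

definition wrap :: "int \<Rightarrow> int \<Rightarrow> int" where
  "wrap r x = (if x < 0 then x + (2 * r + 1) else if x < 2 * r + 1 then x else x - (2 * r + 1))"

text \<open>The second disjunct is the part of the arc that runs past \<open>2 * r\<close> and
  continues at 0.\<close>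

definition in_arc :: "int \<Rightarrow> int \<Rightarrow> int \<Rightarrow> bool" where
  "in_arc r p q \<longleftrightarrow> p \<le> q \<and> q < p + r \<or> q + r + 1 < p"

text \<open>
  \<open>strand r m f q\<close> is the starting point of the arc that strand \<open>f\<close> uses at position \<open>q\<close>. Strand \<open>f\<close>
  covers the arc of \<open>f\<close> and splits the other \<open>r + 1\<close> positions \<open>f + r, \<dots>, f + 2 * r\<close> at the cut point
  into an initial segment of the arc of \<open>f + r\<close> and a final segment of the arc of \<open>f + r + 1\<close>.
  Strand \<open>m\<close> belongs to the edge to the parent, with \<open>m = 0\<close> if there is none. It has its segments
  in the opposite order: a final segment of the arc of \<open>r + 1\<close>, and an initial one of the arc of \<open>0\<close>.
\<close>

definition strand :: "int \<Rightarrow> int \<Rightarrow> int \<Rightarrow> int \<Rightarrow> int" where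
  "strand r m f q =
     (if f \<le> q \<and> q < f + r then f
      else if m < f then (if f + r \<le> q \<or> q < m then f + r else wrap r (f + r + 1))
      else if f < m then (if f + r \<le> q \<and> q < r + m then f + r else f + r + 1)
      else (if m + r \<le> q then r + 1 else 0))"

definition cut_point :: "int \<Rightarrow> int \<Rightarrow> int \<Rightarrow> int" where
  "cut_point r m f = (if m < f then m else r + m)"

text \<open>
  After crossing an edge to a child, positions are counted from the cut point of that edge, and \<open>m\<close> is
  the number that its strand has at the child. The color on the arc starting at \<open>p\<close> comes from the
  arc starting at \<open>next_start r m p\<close>. The starting points \<open>0\<close>, \<open>r + 1\<close> and \<open>m\<close> are those of the strand
  itself, and all other arcs move by \<open>r\<close> or \<open>r + 1\<close>.
\<close>

definition next_start :: "int \<Rightarrow> int \<Rightarrow> int \<Rightarrow> int" where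
  "next_start r m p =
     (if p = 0 then m + r + 1 else if p = r + 1 then m + r else if p = m then m
      else if p < m then p + r else if p \<le> r then p + r + 1
      else if p \<le> m + r then p - r - 1 else p - r)"

lemma strand_range:
  assumes "0 \<le> m" "m \<le> r" "1 \<le> f" "f \<le> r" "0 \<le> q" "q \<le> 2 * r"
  shows "0 \<le> strand r m f q" "strand r m f q \<le> 2 * r"
  using assms by (auto simp: strand_def wrap_def)

lemma in_arc_strand:
  assumes "0 \<le> m" "m \<le> r" "1 \<le> f" "f \<le> r" "0 \<le> q" "q \<le> 2 * r"
  shows "in_arc r (strand r m f q) q"
  using assms by (auto simp: strand_def wrap_def in_arc_def)

text \<open>Two strands share an arc only as its initial and its final segment, divided at the same
  point \<open>m\<close> or \<open>r + m\<close>. Strand \<open>m\<close> fills the gaps left in the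
  arcs of \<open>0\<close> and \<open>r + 1\<close>.\<close>

lemma strand_inj:
  assumes "0 \<le> m" "m \<le> r" "1 \<le> f" "f \<le> r" "1 \<le> f'" "f' \<le> r" "0 \<le> q" "q \<le> 2 * r"
    and "strand r m f q = strand r m f' q"
  shows "f = f'"
  using assms by (auto simp: strand_def wrap_def split: if_splits)

text \<open>Such positions have cyclic distance \<open>r\<close>, whereas two positions of one arc
  are at cyclic distance at most \<open>r - 1\<close>.\<close>

lemma in_arc_disjoint:
  assumes "0 \<le> q" "q \<le> 2 * r" "0 \<le> q'" "q' \<le> 2 * r" "\<bar>q - q'\<bar> = r \<or> \<bar>q - q'\<bar> = r + 1"
    and "in_arc r p q" "in_arc r p q'" "0 \<le> p" "p \<le> 2 * r"
  shows False
  using assms by (auto simp: in_arc_def abs_if split: if_splits)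

text \<open>The arc of \<open>p + r\<close> starts right after that of \<open>p\<close>, and
  together they cover all positions but one.\<close>

lemma in_arc_shift:
  assumes "0 \<le> q" "q \<le> 2 * r" "0 \<le> p" "p \<le> 2 * r"
    and "in_arc r p q" "in_arc r (wrap r (p + r)) q"
  shows False
  using assms by (auto simp: in_arc_def wrap_def split: if_splits)

lemma next_start_bounds:
  assumes "1 \<le> m" "m \<le> r" "0 \<le> p" "p \<le> 2 * r"
  shows "0 \<le> next_start r m p" "next_start r m p \<le> 2 * r + 1"
  using assms by (auto simp: next_start_def)

lemma next_start_range:
  assumes "1 \<le> m" "m \<le> r" "0 \<le> c" "c \<le> 2 * r" "0 \<le> p" "p \<le> 2 * r"
  shows "0 \<le> wrap r (c + next_start r m p)" "wrap r (c + next_start r m p) \<le> 2 * r"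
  using next_start_bounds[OF assms(1,2,5,6)] assms(3,4) by (auto simp: wrap_def)

text \<open>\<open>next_start\<close> maps \<open>{0..2 * r}\<close> bijectively onto
  \<open>{1..2 * r + 1}\<close>, a complete residue system.\<close>

lemma next_start_inj:
  assumes "1 \<le> m" "m \<le> r" "0 \<le> c" "c \<le> 2 * r" "0 \<le> p" "p \<le> 2 * r" "0 \<le> p'" "p' \<le> 2 * r"
    and "wrap r (c + next_start r m p) = wrap r (c + next_start r m p')"
  shows "p = p'"
proof -
  note b = next_start_bounds[OF assms(1,2,5,6)] next_start_bounds[OF assms(1,2,7,8)]
  have "next_start r m p = next_start r m p'
      \<or> next_start r m p = next_start r m p' + (2 * r + 1)
      \<or> next_start r m p' = next_start r m p + (2 * r + 1)"
    using assms(3,4,9) b unfolding wrap_def by (simp split: if_splits)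
  then show ?thesis
    using assms(1,2,5-8) unfolding next_start_def by (auto split: if_splits)
qed

lemma cut_point_range:
  assumes "0 \<le> m" "m \<le> r" "1 \<le> f" "f \<le> r" "f \<noteq> m"
  shows "0 \<le> cut_point r m f" "cut_point r m f \<le> 2 * r" "1 \<le> wrap r (f - cut_point r m f)" "wrap r (f - cut_point r m f) \<le> r"
  using assms by (auto simp: cut_point_def wrap_def)

text \<open>As \<open>c + m'\<close> is \<open>f\<close> modulo \<open>2 * r + 1\<close>, the
  starting points \<open>m'\<close>, \<open>0\<close>, \<open>r + 1\<close> at the child come from
  \<open>f\<close>, \<open>f + r + 1\<close>, \<open>f + r\<close>. Counting from the cut point
  makes the final segment initial and the initial one final.\<close>

lemma strand_next:
  assumes "0 \<le> m" "m \<le> r" "1 \<le> f" "f \<le> r" "f \<noteq> m" "0 \<le> q" "q \<le> 2 * r"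
    and "c = cut_point r m f" "m' = wrap r (f - c)" "q' = wrap r (q - c)"
  shows "wrap r (c + next_start r m' (strand r m' m' q')) = strand r m f q"
proof (cases "m < f")
  case True
  then have c: "c = m" "m' = f - m" using assms by (auto simp: cut_point_def wrap_def)
  show ?thesis using assms(1-7) True unfolding assms(10) c 
    by (auto simp: wrap_def strand_def next_start_def)
next
  case False
  then have c: "c = r + m" "m' = f + r + 1 - m" using assms by (auto simp: cut_point_def wrap_def)
  show ?thesis using assms(1-7) False unfolding assms(10) c 
    by (auto simp: wrap_def strand_def next_start_def)
qed

text \<open>An arc moved by \<open>r\<close> or \<open>r + 1\<close> is disjoint from its image. The
  arc of \<open>m'\<close> stays in place, and those of \<open>0\<close> and \<open>r + 1\<close>
  meet their images exactly in the segments that strand \<open>m'\<close> uses.\<close>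

lemma in_arc_next:
  assumes "0 \<le> m" "m \<le> r" "1 \<le> f" "f \<le> r" "f \<noteq> m" "0 \<le> q" "q \<le> 2 * r"
    and "c = cut_point r m f" "m' = wrap r (f - c)" "q' = wrap r (q - c)"
    and "0 \<le> p" "p \<le> 2 * r"
    and "in_arc r p q'" "in_arc r (wrap r (c + next_start r m' p)) q"
  shows "wrap r (c + next_start r m' p) = strand r m f q"
proof (cases "m < f")
  case True
  then have c: "c = m" "m' = f - m" using assms by (auto simp: cut_point_def wrap_def)
  show ?thesis using assms(1-7,11-) True unfolding assms(10) c in_arc_def
    by (auto simp: wrap_def strand_def next_start_def split: if_splits)
next
  case False
  then have c: "c = r + m" "m' = f + r + 1 - m" using assms by (auto simp: cut_point_def wrap_def)
  show ?thesis using assms(1-7,11-) False unfolding assms(10) c in_arc_def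
    by (auto simp: wrap_def strand_def next_start_def split: if_splits)
qed

section \<open>Colored stars\<close>

text \<open>
  A star \<open>(a, m, g)\<close> counts positions from \<open>a\<close>, has parent strand \<open>m\<close> (or \<open>m = 0\<close>), and uses the
  color \<open>g p\<close> on the arc starting at \<open>p\<close>.
\<close>

type_synonym star = "int \<times> int \<times> (int \<Rightarrow> int)"

fun valid_star :: "int \<Rightarrow> star \<Rightarrow> bool" where
  "valid_star r (a, m, g) \<longleftrightarrow> 0 \<le> a \<and> a \<le> 2 * r \<and> 0 \<le> m \<and> m \<le> r \<and>
     inj_on g {0..2 * r} \<and> g ` {0..2 * r} \<subseteq> {0..2 * r}"

fun parent_strand :: "star \<Rightarrow> int" where
  "parent_strand (a, m, g) = m"

fun strand_color :: "int \<Rightarrow> star \<Rightarrow> int \<Rightarrow> int \<Rightarrow> int" where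
  "strand_color r (a, m, g) f q = g (strand r m f (wrap r (q - a)))"

fun star_colors :: "int \<Rightarrow> star \<Rightarrow> int \<Rightarrow> int set" where
  "star_colors r (a, m, g) q = g ` {p \<in> {0..2 * r}. in_arc r p (wrap r (q - a))}"

fun cross_star :: "int \<Rightarrow> star \<Rightarrow> int \<Rightarrow> star" where
  "cross_star r (a, m, g) f =
     (wrap r (a + cut_point r m f), wrap r (f - cut_point r m f),
      \<lambda>p. g (wrap r (cut_point r m f + next_start r (wrap r (f - cut_point r m f)) p)))"

text \<open>The effect of an edge whose color belongs to another of the \<open>k\<close> parts.\<close>

fun shift_star :: "int \<Rightarrow> star \<Rightarrow> star" where
  "shift_star r (a, m, g) = (a, 0, \<lambda>p. g (wrap r (p + r)))"

lemma wrap_diff_range: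
  assumes "0 \<le> q" "q \<le> 2 * r" "0 \<le> a" "a \<le> 2 * r"
  shows "0 \<le> wrap r (q - a)" "wrap r (q - a) \<le> 2 * r"
  using assms by (auto simp: wrap_def)

lemma wrap_diff_wrap_add:
  assumes "0 \<le> q" "q \<le> 2 * r" "0 \<le> a" "a \<le> 2 * r" "0 \<le> c" "c \<le> 2 * r"
  shows "wrap r (q - wrap r (a + c)) = wrap r (wrap r (q - a) - c)"
  using assms by (auto simp: wrap_def)

lemma strand_color_in_star_colors:
  assumes "valid_star r s" "1 \<le> f" "f \<le> r" "0 \<le> q" "q \<le> 2 * r"
  shows "strand_color r s f q \<in> star_colors r s q"
proof (cases s)
  case (fields a m g)
  then show ?thesis
    using assms wrap_diff_range[of q r a] strand_range[of m r f "wrap r (q - a)"]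
      in_arc_strand[of m r f "wrap r (q - a)"] by auto
qed

lemma star_colors_range:
  assumes "valid_star r s"
  shows "star_colors r s q \<subseteq> {0..2 * r}"
  using assms by (cases s) auto

lemma strand_color_inj:
  assumes "valid_star r s" "1 \<le> f" "f \<le> r" "1 \<le> f'" "f' \<le> r" "0 \<le> q" "q \<le> 2 * r"
    and "strand_color r s f q = strand_color r s f' q"
  shows "f = f'"
proof (cases s)
  case (fields a m g)
  let ?q = "wrap r (q - a)"
  have q: "0 \<le> ?q" "?q \<le> 2 * r" using assms fields wrap_diff_range[of q r a] by auto
  have "strand r m f ?q = strand r m f' ?q"
    using assms fields q strand_range[of m r f ?q] strand_range[of m r f' ?q]
    by (auto dest: inj_onD)
  then show ?thesis using strand_inj[of m r f f' ?q] assms fields q by auto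
qed

lemma star_colors_disjoint:
  assumes "valid_star r s" "0 \<le> q" "q \<le> 2 * r" "0 \<le> q'" "q' \<le> 2 * r"
    and "\<bar>q - q'\<bar> = r \<or> \<bar>q - q'\<bar> = r + 1"
  shows "star_colors r s q \<inter> star_colors r s q' = {}"
proof (cases s)
  case (fields a m g)
  let ?q = "wrap r (q - a)" and ?q' = "wrap r (q' - a)"
  have q: "0 \<le> ?q" "?q \<le> 2 * r" "0 \<le> ?q'" "?q' \<le> 2 * r"
    using assms fields wrap_diff_range[of q r a] wrap_diff_range[of q' r a] by auto
  have "\<bar>?q - ?q'\<bar> = r \<or> \<bar>?q - ?q'\<bar> = r + 1"
    using assms fields by (auto simp: wrap_def)
  then show ?thesis
    using in_arc_disjoint[OF q] assms(1) fields by (auto dest!: inj_onD)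
qed

lemma valid_star_cross:
  assumes "valid_star r s" "1 \<le> f" "f \<le> r" "f \<noteq> parent_strand s"
  shows "valid_star r (cross_star r s f)" "1 \<le> parent_strand (cross_star r s f)" "parent_strand (cross_star r s f) \<le> r"
proof -
  obtain a m g where s: "s = (a, m, g)" by (cases s)
  let ?c = "cut_point r m f"
  let ?m = "wrap r (f - ?c)"
  have c: "0 \<le> ?c" "?c \<le> 2 * r" "1 \<le> ?m" "?m \<le> r"
    using cut_point_range[of m r f] assms s by auto
  have "inj_on (\<lambda>p. g (wrap r (?c + next_start r ?m p))) {0..2 * r}"
  proof (rule inj_onI)
    fix p p' assume p: "p \<in> {0..2 * r}" "p' \<in> {0..2 * r}"
      and eq: "g (wrap r (?c + next_start r ?m p)) = g (wrap r (?c + next_start r ?m p'))"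
    have "wrap r (?c + next_start r ?m p) = wrap r (?c + next_start r ?m p')"
      using inj_onD[of g "{0..2 * r}", OF _ eq] p next_start_range[OF c(3,4,1,2), of p]
        next_start_range[OF c(3,4,1,2), of p'] assms(1) s by simp
    then show "p = p'" using next_start_inj[OF c(3,4,1,2)] p by simp
  qed
  moreover have "0 \<le> wrap r (a + ?c)" "wrap r (a + ?c) \<le> 2 * r"
    using assms(1) s c by (auto simp: wrap_def)
  moreover have "(\<lambda>p. g (wrap r (?c + next_start r ?m p))) ` {0..2 * r} \<subseteq> {0..2 * r}"
  proof (rule image_subsetI)
    fix p assume "p \<in> {0..2 * r}"
    then have "wrap r (?c + next_start r ?m p) \<in> {0..2 * r}"
      using next_start_range[OF c(3,4,1,2), of p] by simp
    moreover have "g ` {0..2 * r} \<subseteq> {0..2 * r}" using assms(1) s by simp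
    ultimately show "g (wrap r (?c + next_start r ?m p)) \<in> {0..2 * r}" by blast
  qed
  ultimately show "valid_star r (cross_star r s f)" using c unfolding s cross_star.simps valid_star.simps by linarith
  show "1 \<le> parent_strand (cross_star r s f)" "parent_strand (cross_star r s f) \<le> r" using c s by simp_all
qed

lemma strand_color_cross:
  assumes "valid_star r s" "1 \<le> f" "f \<le> r" "f \<noteq> parent_strand s" "0 \<le> q" "q \<le> 2 * r"
  shows "strand_color r (cross_star r s f) (parent_strand (cross_star r s f)) q = strand_color r s f q"
proof -
  obtain a m g where s: "s = (a, m, g)" by (cases s)
  have c: "0 \<le> cut_point r m f" "cut_point r m f \<le> 2 * r"
    using cut_point_range[of m r f] assms s by auto
  have a: "0 \<le> a" "a \<le> 2 * r" using assms s by auto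
  have "wrap r (q - wrap r (a + cut_point r m f)) = wrap r (wrap r (q - a) - cut_point r m f)"
    using wrap_diff_wrap_add[of q r a] a assms(5,6) c by simp
  then show ?thesis
    using strand_next[OF _ _ assms(2,3), of m "wrap r (q - a)"] assms s
      wrap_diff_range[OF assms(5,6) a] by simp
qed

lemma star_colors_cross:
  assumes "valid_star r s" "1 \<le> f" "f \<le> r" "f \<noteq> parent_strand s" "0 \<le> q" "q \<le> 2 * r"
  shows "star_colors r s q \<inter> star_colors r (cross_star r s f) q \<subseteq> {strand_color r s f q}"
proof -
  obtain a m g where s: "s = (a, m, g)" by (cases s)
  let ?c = "cut_point r m f" and ?q = "wrap r (q - a)"
  let ?m = "wrap r (f - ?c)"
  have c: "0 \<le> ?c" "?c \<le> 2 * r" "1 \<le> ?m" "?m \<le> r"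
    using cut_point_range[of m r f] assms s by auto
  have a: "0 \<le> a" "a \<le> 2 * r" using assms s by auto
  have q: "wrap r (q - wrap r (a + ?c)) = wrap r (?q - ?c)"
    using wrap_diff_wrap_add[of q r a] a assms(5,6) c by simp
  show ?thesis
  proof
    fix x assume x: "x \<in> star_colors r s q \<inter> star_colors r (cross_star r s f) q"
    then obtain p p' where p: "p \<in> {0..2 * r}" "in_arc r p ?q" "x = g p"
      and p': "p' \<in> {0..2 * r}" "in_arc r p' (wrap r (?q - ?c))"
        "x = g (wrap r (?c + next_start r ?m p'))"
      using s q by auto
    have "p = wrap r (?c + next_start r ?m p')"
      using p p' next_start_range[OF c(3,4,1,2), of p'] assms(1) s by (auto dest: inj_onD)
    then show "x \<in> {strand_color r s f q}"
      using in_arc_next[of m r f ?q ?c ?m "wrap r (?q - ?c)" p'] p p' assms s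
        wrap_diff_range[OF assms(5,6) a] by auto
  qed
qed

lemma wrap_shift:
  assumes "0 \<le> p" "p \<le> 2 * r" "0 \<le> r"
  shows "0 \<le> wrap r (p + r)" "wrap r (p + r) \<le> 2 * r"
  using assms by (auto simp: wrap_def)

lemma valid_star_shift:
  assumes "valid_star r s"
  shows "valid_star r (shift_star r s)" "parent_strand (shift_star r s) = 0"
proof -
  obtain a m g where s: "s = (a, m, g)" by (cases s)
  have "inj_on (\<lambda>p. g (wrap r (p + r))) {0..2 * r}"
  proof (rule inj_onI)
    fix p p' assume p: "p \<in> {0..2 * r}" "p' \<in> {0..2 * r}"
      and "g (wrap r (p + r)) = g (wrap r (p' + r))"
    then have "wrap r (p + r) = wrap r (p' + r)"
      using assms s wrap_shift[of p r] wrap_shift[of p' r] by (auto dest: inj_onD)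
    then show "p = p'" using p by (auto simp: wrap_def split: if_splits)
  qed
  then show "valid_star r (shift_star r s)" "parent_strand (shift_star r s) = 0"
    using assms s wrap_shift[of _ r] by auto
qed

lemma star_colors_shift:
  assumes "valid_star r s" "0 \<le> q" "q \<le> 2 * r"
  shows "star_colors r s q \<inter> star_colors r (shift_star r s) q = {}"
proof -
  obtain a m g where s: "s = (a, m, g)" by (cases s)
  let ?q = "wrap r (q - a)"
  have a: "0 \<le> ?q" "?q \<le> 2 * r" using assms s wrap_diff_range[of q r a] by auto
  have False if "p \<in> {0..2 * r}" "in_arc r p ?q" "p' \<in> {0..2 * r}" "in_arc r p' ?q"
    "g p = g (wrap r (p' + r))" for p p'
    using in_arc_shift[OF a, of p'] that wrap_shift[of p' r] assms(1) s by (auto dest: inj_onD)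
  then show ?thesis using s by auto
qed

section \<open>Folding the long cycle onto shorter ones\<close>

text \<open>
  Reduces the cycle of length \<open>2 * l + 1\<close> homomorphically to one of length \<open>2 * r + 1\<close>, whose
  vertices are numbered so that neighbors are \<open>r\<close> or \<open>r + 1\<close> apart.
\<close>

definition position :: "nat \<Rightarrow> nat \<Rightarrow> int" where
  "position r i = (if even i then min (int i div 2) (int r)
     else min ((int i + 1) div 2 + int r) (2 * int r))"

lemma position_range: "0 \<le> position r i" "position r i \<le> 2 * int r"
  by (auto simp: position_def)

text \<open>The steps alternate between \<open>r + 1\<close> up and \<open>r\<close> down until the
  values settle at \<open>r\<close> and \<open>2 * r\<close>. Since \<open>r \<le> l\<close>, vertex
  \<open>2 * l\<close> sits at \<open>r\<close>, which gives the closing step to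
  \<open>0\<close>.\<close>

lemma position_adjacent:
  assumes "r \<le> l" "(i, j) \<in> parcs (cycle_graph (2 * l + 1))"
  shows "\<bar>position r i - position r j\<bar> = int r \<or> \<bar>position r i - position r j\<bar> = int r + 1"
proof -
  have Suc: "\<bar>position r i - position r (Suc i)\<bar> \<in> {int r, int r + 1}" for i
  proof (cases "even i")
    case True
    then obtain k where "i = 2 * k" by (elim evenE)
    then show ?thesis by (auto simp: position_def min_def)
  next
    case False
    then obtain k where "i = 2 * k + 1" by (elim oddE)
    then show ?thesis by (auto simp: position_def min_def)
  qed
  have wrap: "\<bar>position r (2 * l) - position r 0\<bar> = int r"
    using assms(1) by (auto simp: position_def min_def)
  have "j = Suc i \<or> i = Suc j \<or> i = 2 * l \<and> j = 0 \<or> i = 0 \<and> j = 2 * l"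
    using assms(2) by (auto simp: cycle_graph_def mod_Suc split: if_splits)
  then show ?thesis using Suc[of i] Suc[of j] wrap by (auto simp: abs_minus_commute)
qed

section \<open>Propagation along a tree\<close>

definition neighbors :: "'a pair_pre_digraph \<Rightarrow> 'a \<Rightarrow> 'a set" where
  "neighbors G v = {w. (v, w) \<in> parcs G}"

lemma card_neighbors_le_max_degree:
  assumes "pair_graph G" "v \<in> pverts G"
  shows "finite (neighbors G v)" "card (neighbors G v) \<le> max_degree G"
proof -
  interpret pair_graph G by fact
  have n: "neighbors G v = snd ` out_arcs (with_proj G) v"
    by (force simp: neighbors_def out_arcs_def)
  have fin: "finite (out_arcs (with_proj G) v)"
    using pair_finite_arcs by (auto simp: out_arcs_def)
  then show "finite (neighbors G v)" using n by simp
  have "card (neighbors G v) \<le> out_degree (with_proj G) v"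
    unfolding n out_degree_def using fin by (rule card_image_le)
  also have "\<dots> \<le> max_degree G"
    unfolding max_degree_def using assms(2) pair_finite_verts by (intro Max_ge) auto
  finally show "card (neighbors G v) \<le> max_degree G" .
qed

definition path_connected_in :: "'a pair_pre_digraph \<Rightarrow> 'a set \<Rightarrow> bool" where
  "path_connected_in G A \<longleftrightarrow> (\<forall>a\<in>A. \<forall>b\<in>A. \<exists>p. pre_digraph.apath (with_proj G) a p b \<and>
     set (pawalk_verts a p) \<subseteq> A)"

text \<open>Otherwise a path inside \<open>A\<close> from \<open>v\<close> to \<open>v'\<close>
  closes through \<open>w\<close> to a cycle of length at least 3.\<close>

lemma tree_unique_neighbor:
  assumes T: "tree_graph T" and A: "path_connected_in T A"
    and w: "w \<notin> A" "v \<in> A" "v' \<in> A" "(w, v) \<in> parcs T" "(w, v') \<in> parcs T"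
  shows "v = v'"
proof (rule ccontr)
  assume ne: "v \<noteq> v'"
  interpret pair_graph T using T by (simp add: tree_graph_def)
  obtain p where p: "apath v p v'" "set (awalk_verts v p) \<subseteq> A"
    using A[unfolded path_connected_in_def] w(2,3) by meson
  have pne: "p \<noteq> []" using p ne by (auto simp: apath_Nil_iff)
  have v'w: "(v', w) \<in> parcs T" using w arcs_symmetric by auto
  have aw: "awalk v p v'" and d: "distinct (awalk_verts v p)" using p by (auto simp: apath_def)
  let ?c = "(w, v) # p @ [(v', w)]"
  have "awalk w ?c w"
    using aw w v'w by (auto simp: awalk_Cons_iff awalk_Nil_iff dest: wellformed')
  moreover have "awalk v (p @ [(v', w)]) w"
    using aw v'w by (auto simp: awalk_Cons_iff awalk_Nil_iff dest: wellformed')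
  then have "awalk_verts v (p @ [(v', w)]) = awalk_verts v p @ [w]"
    using aw by (simp add: awalk_verts_append)
  then have "distinct (tl (awalk_verts w ?c))" using d p(2) w(1) by auto
  ultimately have "cycle ?c" unfolding cycle_def by blast
  moreover have "3 \<le> length ?c" using pne by (cases p) auto
  ultimately show False using T by (auto simp: tree_graph_def)
qed

lemma path_connected_in_insert:
  assumes "pair_graph T" and A: "path_connected_in T A" "v \<in> A" "w \<notin> A" "(v, w) \<in> parcs T"
  shows "path_connected_in T (insert w A)"
proof -
  interpret pair_graph T by fact
  have wv: "(w, v) \<in> parcs T" using A arcs_symmetric by auto
  have to: "\<exists>p. apath a p w \<and> set (awalk_verts a p) \<subseteq> insert w A" if a: "a \<in> A" for a
  proof -
    obtain p where p: "apath a p v" "set (awalk_verts a p) \<subseteq> A"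
      using A(1)[unfolded path_connected_in_def] a A(2) by meson
    have aw: "awalk a (p @ [(v, w)]) w"
      using p A(4) by (auto simp: apath_def awalk_Cons_iff awalk_Nil_iff dest: wellformed')
    have "awalk_verts a (p @ [(v, w)]) = awalk_verts a p @ [w]"
      using awalk_verts_append[OF aw] by simp
    then have "apath a (p @ [(v, w)]) w" "set (awalk_verts a (p @ [(v, w)])) \<subseteq> insert w A"
      using p A(3) aw by (auto simp: apath_def)
    then show ?thesis by blast
  qed
  have "from": "\<exists>p. apath w p b \<and> set (awalk_verts w p) \<subseteq> insert w A" if b: "b \<in> A" for b
  proof -
    obtain p where p: "apath v p b" "set (awalk_verts v p) \<subseteq> A"
      using A(1)[unfolded path_connected_in_def] b A(2) by meson
    then have "apath w ((w, v) # p) b" "set (awalk_verts w ((w, v) # p)) \<subseteq> insert w A"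
      using A wv by (auto simp: apath_Cons_iff dest: wellformed')
    then show ?thesis by blast
  qed
  have "apath w [] w" using A(4) by (auto simp: apath_Nil_iff dest: wellformed')
  then have "\<exists>p. apath w p w \<and> set (awalk_verts w p) \<subseteq> insert w A" by fastforce
  moreover have "\<exists>p. apath a p b \<and> set (awalk_verts a p) \<subseteq> insert w A" if "a \<in> A" "b \<in> A" for a b
    using A(1)[unfolded path_connected_in_def, rule_format, OF that] by blast
  ultimately show ?thesis using to "from" unfolding path_connected_in_def by blast
qed

lemma connected_crossing_arc:
  assumes T: "tree_graph T" and A: "A \<subseteq> pverts T" "A \<noteq> {}" "A \<noteq> pverts T"
  obtains v w where "v \<in> A" "w \<notin> A" "(v, w) \<in> parcs T"
proof -
  interpret pair_graph T using T by (simp add: tree_graph_def)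
  obtain a b where ab: "a \<in> A" "b \<in> pverts T" "b \<notin> A" using A by blast
  have "a \<rightarrow>\<^sup>*\<^bsub>mk_symmetric (with_proj T)\<^esub> b"
    using T ab A by (auto simp: tree_graph_def connected_def strongly_connected_def)
  then have "a \<rightarrow>\<^sup>*\<^bsub>with_proj T\<^esub> b" using reachable_mk_symmetric_eq[OF sym_arcs] by simp
  then obtain p where "awalk a p b" by (auto simp: reachable_awalk)
  then have "\<exists>v w. v \<in> A \<and> w \<notin> A \<and> (v, w) \<in> parcs T" using ab(1,3)
  proof (induction p arbitrary: a)
    case Nil then show ?case by (auto simp: awalk_Nil_iff)
  next
    case (Cons e p)
    then have e: "e \<in> parcs T" "fst e = a" "awalk (snd e) p b" by (auto simp: awalk_Cons_iff)
    show ?case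
    proof (cases "snd e \<in> A")
      case True then show ?thesis using Cons.IH[OF e(3)] Cons.prems by blast
    next
      case False then show ?thesis using e Cons.prems by (metis prod.collapse)
    qed
  qed
  then show ?thesis using that by blast
qed

text \<open>
  States and slots are propagated from a root: a vertex uses distinct slots for its incident
  edges, and the slots \<open>rsv s\<close> of a state \<open>s\<close> are only available for the edge to the parent.
\<close>

lemma tree_labelling:
  fixes T :: "'a pair_pre_digraph" and V :: "'s \<Rightarrow> bool" and K :: "'k set"
  assumes T: "tree_graph T" and K: "finite K" "max_degree T \<le> card K"
    and init: "V s\<^sub>0" "rsv s\<^sub>0 = {}"
    and step: "\<And>s \<kappa>. V s \<Longrightarrow> \<kappa> \<in> K \<Longrightarrow> \<kappa> \<notin> rsv s \<Longrightarrow>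
      \<exists>s' \<kappa>'. V s' \<and> \<kappa>' \<in> K \<and> rsv s' \<subseteq> {\<kappa>'} \<and> R s \<kappa> s' \<kappa>'"
    and sym: "\<And>s \<kappa> s' \<kappa>'. R s \<kappa> s' \<kappa>' \<Longrightarrow> R s' \<kappa>' s \<kappa>"
  shows "\<exists>(st :: 'a \<Rightarrow> 's) (sl :: 'a \<Rightarrow> 'a \<Rightarrow> 'k).
    (\<forall>v\<in>pverts T. V (st v) \<and> inj_on (sl v) (neighbors T v)) \<and>
    (\<forall>v w. (v, w) \<in> parcs T \<longrightarrow> sl v w \<in> K \<and> R (st v) (sl v w) (st w) (sl w v))"
proof -
  interpret pair_graph T using T by (simp add: tree_graph_def)
  \<comment> \<open>Labels are required only inside \<open>A\<close>. Reserved slots are among those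
    already used there, so every slot still free at a vertex is admissible in
    \<open>step\<close>.\<close>
  define good where "good A \<longleftrightarrow> A \<subseteq> pverts T \<and> path_connected_in T A \<and>
    (\<exists>st sl. (\<forall>v\<in>A. V (st v) \<and> inj_on (sl v) (neighbors T v \<inter> A) \<and> sl v ` (neighbors T v \<inter> A) \<subseteq> K
        \<and> rsv (st v) \<subseteq> sl v ` (neighbors T v \<inter> A)
        \<and> (\<forall>w\<in>neighbors T v \<inter> A. R (st v) (sl v w) (st w) (sl w v))))" for A
  have extend: "\<exists>w. w \<in> pverts T - A \<and> good (insert w A)"
    if g: "good A" and A: "A \<noteq> {}" "A \<noteq> pverts T" for A
  proof -
    have sub: "A \<subseteq> pverts T" and pc: "path_connected_in T A" using g by (auto simp: good_def)
    obtain v w where vw: "v \<in> A" "w \<notin> A" "(v, w) \<in> parcs T"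
      using connected_crossing_arc[OF T sub A] by blast
    have w: "w \<in> pverts T" "(w, v) \<in> parcs T" "v \<noteq> w"
      using vw arcs_symmetric by (auto dest: wellformed')
    have nbrw: "neighbors T w \<inter> A = {v}"
      using tree_unique_neighbor[OF T pc vw(2)] vw w by (auto simp: neighbors_def)
    have nbru: "w \<in> neighbors T u \<longleftrightarrow> u = v" if "u \<in> A" for u
      using nbrw that arcs_symmetric vw by (auto simp: neighbors_def)
    have nbrww: "w \<notin> neighbors T w" using no_loops' by (auto simp: neighbors_def)
    obtain st sl where st: "\<And>v. v \<in> A \<Longrightarrow> V (st v)"
      and inj: "\<And>v. v \<in> A \<Longrightarrow> inj_on (sl v) (neighbors T v \<inter> A)"
      and sK: "\<And>v. v \<in> A \<Longrightarrow> sl v ` (neighbors T v \<inter> A) \<subseteq> K"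
      and rs: "\<And>v. v \<in> A \<Longrightarrow> rsv (st v) \<subseteq> sl v ` (neighbors T v \<inter> A)"
      and R: "\<And>v w. v \<in> A \<Longrightarrow> w \<in> neighbors T v \<inter> A \<Longrightarrow> R (st v) (sl v w) (st w) (sl w v)"
      using g unfolding good_def by metis
    have fin: "finite (neighbors T v)" and deg: "card (neighbors T v) \<le> max_degree T"
      using card_neighbors_le_max_degree[of T v] sub vw pair_graph by auto
    \<comment> \<open>The neighbor \<open>w\<close> outside \<open>A\<close> leaves at least one
      slot free at \<open>v\<close>.\<close>
    have "card (sl v ` (neighbors T v \<inter> A)) \<le> card (neighbors T v \<inter> A)"
      using fin by (intro card_image_le) auto
    also have "\<dots> < card (neighbors T v)"
      using fin vw by (intro psubset_card_mono) (auto simp: neighbors_def)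
    also have "\<dots> \<le> card K" using deg K by simp
    finally have "\<not> K \<subseteq> sl v ` (neighbors T v \<inter> A)" using fin by (auto dest!: card_mono[rotated])
    then obtain k where k: "k \<in> K" "k \<notin> sl v ` (neighbors T v \<inter> A)" by blast
    then obtain s' k' where s': "V s'" "k' \<in> K" "rsv s' \<subseteq> {k'}" "R (st v) k s' k'"
      using step[of "st v" k] st[OF vw(1)] rs[OF vw(1)] by blast
    define st' where "st' = st(w := s')"
    \<comment> \<open>A constant suffices at \<open>w\<close>, whose only neighbor in
      \<open>A\<close> is \<open>v\<close>.\<close>
    define sl' where "sl' = sl(v := (sl v)(w := k), w := (\<lambda>_. k'))"
    have N: "neighbors T u \<inter> insert w A = (if u = w then {v} else if u = v then insert w (neighbors T v \<inter> A)
      else neighbors T u \<inter> A)" if "u \<in> insert w A" for u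
      using that nbru nbrw nbrww by auto
    have "V (st' u) \<and> inj_on (sl' u) (neighbors T u \<inter> insert w A) \<and> sl' u ` (neighbors T u \<inter> insert w A) \<subseteq> K
        \<and> rsv (st' u) \<subseteq> sl' u ` (neighbors T u \<inter> insert w A)
        \<and> (\<forall>x\<in>neighbors T u \<inter> insert w A. R (st' u) (sl' u x) (st' x) (sl' x u))"
      if u: "u \<in> insert w A" for u
    proof -
      consider "u = w" | "u = v" | "u \<in> A" "u \<noteq> v" "u \<noteq> w" using u by blast
      then show ?thesis
      proof cases
        case 1
        then show ?thesis
          unfolding N[OF u] st'_def sl'_def using s' w(3) sym by auto
      next
        case 2
        have wA: "w \<notin> neighbors T v \<inter> A" using vw by blast
        have im: "(sl v)(w := k) ` (neighbors T v \<inter> A) = sl v ` (neighbors T v \<inter> A)"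
          using wA by (intro image_cong) auto
        have "inj_on ((sl v)(w := k)) (neighbors T v \<inter> A)"
          using inj[OF vw(1)] wA by (auto simp: inj_on_def)
        moreover have "R (st v) (sl v x) (st x) (sl x v)" "x \<noteq> w" "x \<noteq> v" if "x \<in> neighbors T v \<inter> A" for x
          using R[OF vw(1) that] that vw no_loops' by (auto simp: neighbors_def)
        ultimately show ?thesis
          unfolding N[OF u] using 2 w(3) st[OF vw(1)] sK[OF vw(1)] rs[OF vw(1)] k s' wA im
          by (auto simp: st'_def sl'_def)
      next
        case 3
        have "R (st' u) (sl' u x) (st' x) (sl' x u)" if "x \<in> neighbors T u \<inter> A" for x
          using R[OF 3(1) that] that 3 vw by (auto simp: st'_def sl'_def)
        then show ?thesis
          unfolding N[OF u] using 3 st inj sK rs by (auto simp: st'_def sl'_def)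
      qed
    qed
    then have "good (insert w A)"
      unfolding good_def using sub w path_connected_in_insert[OF _ pc vw] pair_graph by blast
    then show ?thesis using w vw by blast
  qed
  have "pverts T \<noteq> {}"
    using T by (auto simp: tree_graph_def connected_def strongly_connected_def)
  then obtain r where r: "r \<in> pverts T" by blast
  have "apath r [] r" using r by (auto simp: apath_Nil_iff)
  then have "path_connected_in T {r}" unfolding path_connected_in_def by fastforce
  moreover have "neighbors T r \<inter> {r} = {}" using no_loops' by (auto simp: neighbors_def)
  ultimately have g0: "good {r}" unfolding good_def using r init by auto
  have "good (pverts T)" if "good A" "A \<noteq> {}" for A
    using that
  proof (induction "card (pverts T - A)" arbitrary: A rule: less_induct)
    case less
    show ?case
    proof (cases "A = pverts T")
      case False
      then obtain w where "w \<in> pverts T - A" "good (insert w A)" using extend less.prems by blast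
      moreover from this have "card (pverts T - insert w A) < card (pverts T - A)"
        using pair_finite_verts by (intro psubset_card_mono) auto
      ultimately show ?thesis using less.hyps by blast
    qed (use less.prems in simp)
  qed
  from this[OF g0] have "good (pverts T)" by simp
  moreover have "neighbors T v \<inter> pverts T = neighbors T v" for v by (auto simp: neighbors_def dest: wellformed')
  ultimately obtain st sl where *: "\<And>v. v \<in> pverts T \<Longrightarrow> V (st v) \<and> inj_on (sl v) (neighbors T v)
      \<and> sl v ` neighbors T v \<subseteq> K \<and> (\<forall>w\<in>neighbors T v. R (st v) (sl v w) (st w) (sl w v))"
    unfolding good_def by metis
  show ?thesis
    by (rule exI[of _ st], rule exI[of _ sl]) (use * in \<open>auto simp: neighbors_def dest: wellformed'\<close>)
qed

section \<open>Strong edge colorings\<close>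

text \<open>Colors of any type may be given on arcs. In \<open>sep\<close> only first endpoints are
  compared: by symmetry, arcs can be reversed to bring the equal or adjacent endpoints
  there.\<close>

lemma strong_chromatic_index_le_card:
  fixes C :: "'a \<Rightarrow> 'a \<Rightarrow> 'c"
  assumes "pair_graph G" and P: "finite P"
    and CP: "\<And>x y. (x, y) \<in> parcs G \<Longrightarrow> C x y \<in> P"
    and sym: "\<And>x y. (x, y) \<in> parcs G \<Longrightarrow> C x y = C y x"
    and sep: "\<And>x y x' y'. (x, y) \<in> parcs G \<Longrightarrow> (x', y') \<in> parcs G \<Longrightarrow> C x y = C x' y' \<Longrightarrow>
      x = x' \<or> (x, x') \<in> parcs G \<Longrightarrow> {x, y} = {x', y'}"
  shows "strong_chromatic_index G \<le> card P"
proof -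
  interpret pair_graph G by fact
  obtain h :: "'c \<Rightarrow> nat" where h: "bij_betw h P {..<card P}"
    using ex_bij_betw_finite_nat[OF P] by (auto simp: atLeast0LessThan)
  define c where "c e = h (let (x, y) = (SOME (x, y). (x, y) \<in> parcs G \<and> e = {x, y}) in C x y)" for e
  have c: "c {x, y} = h (C x y)" if xy: "(x, y) \<in> parcs G" for x y
  proof -
    have "\<exists>z. case z of (u, v) \<Rightarrow> (u, v) \<in> parcs G \<and> {x, y} = {u, v}" using xy by blast
    from someI_ex[OF this] obtain u v
      where uv: "(SOME (u, v). (u, v) \<in> parcs G \<and> {x, y} = {u, v}) = (u, v)"
        "(u, v) \<in> parcs G" "{x, y} = {u, v}"
      by (smt (verit, best) case_prodE case_prod_conv)
    then have "C u v = C x y" using sym by (auto simp: doubleton_eq_iff)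
    then show ?thesis using uv(1) by (simp add: c_def)
  qed
  have sep': "e = f" if e: "e \<in> edges G" "f \<in> edges G" "c e = c f"
    and x: "x \<in> e" "x' \<in> f" "x = x' \<or> (x, x') \<in> parcs G" for e f x x'
  proof -
    obtain y where y: "e = {x, y}" "(x, y) \<in> parcs G"
      using e(1) x(1) arcs_symmetric by (auto simp: edges_def)
    obtain y' where y': "f = {x', y'}" "(x', y') \<in> parcs G"
      using e(2) x(2) arcs_symmetric by (auto simp: edges_def)
    have "C x y = C x' y'"
      using e(3) c y y' CP bij_betw_imp_inj_on[OF h] by (metis inj_onD)
    then show ?thesis using sep y y' x(3) by metis
  qed
  have "proper_edge_coloring G c"
    unfolding proper_edge_coloring_def using sep' by blast
  moreover have "induced_matching G {e \<in> edges G. c e = k}" for k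
    unfolding induced_matching_def matching_def
  proof (intro conjI ballI impI)
    show "e \<inter> f = {}" if "e \<in> {e \<in> edges G. c e = k}" "f \<in> {e \<in> edges G. c e = k}" "e \<noteq> f" for e f
      using that sep' by blast
    fix e assume e: "e \<in> edges G" "e \<subseteq> \<Union> {e \<in> edges G. c e = k}"
    then obtain x y where xy: "e = {x, y}" "(x, y) \<in> parcs G" by (auto simp: edges_def)
    obtain f g where f: "f \<in> edges G" "c f = k" "x \<in> f" and g: "g \<in> edges G" "c g = k" "y \<in> g"
      using e xy by blast
    have "f = g" using sep'[of f g x y] f g xy by simp
    moreover have "x \<noteq> y" using no_loops' xy by auto
    moreover obtain u v where "f = {u, v}" using f by (auto simp: edges_def)
    ultimately have "e = f" using f g xy by auto
    then show "e \<in> {e \<in> edges G. c e = k}" using f by simp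
  qed auto
  ultimately have "strong_edge_coloring G c" by (simp add: strong_edge_coloring_def)
  moreover have "c ` edges G \<subseteq> {..<card P}"
    using c CP bij_betw_imp_surj_on[OF h] by (auto simp: edges_def)
  ultimately show ?thesis
    unfolding strong_chromatic_index_def by (intro Least_le) blast
qed

section \<open>Five colors for the copies of the cycle\<close>

text \<open>The pairs belong to three consecutive cycle edges. Conflicts reach two edges ahead
  within one copy of the cycle and one edge ahead between adjacent copies.\<close>

definition separated :: "nat \<times> nat \<Rightarrow> nat \<times> nat \<Rightarrow> nat \<times> nat \<Rightarrow> bool" where
  "separated p q r \<longleftrightarrow> fst p \<notin> {fst q, fst r, snd p, snd q} \<and> snd p \<notin> {fst p, snd q, snd r, fst q}"

fun windows_separated :: "(nat \<times> nat) list \<Rightarrow> bool" where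
  "windows_separated (p # q # r # ps) \<longleftrightarrow> separated p q r \<and> windows_separated (q # r # ps)"
| "windows_separated _ \<longleftrightarrow> True"

lemma windows_separated_nth:
  "windows_separated ps \<Longrightarrow> Suc (Suc i) < length ps \<Longrightarrow>
    separated (ps ! i) (ps ! Suc i) (ps ! Suc (Suc i))"
proof (induction ps arbitrary: i rule: windows_separated.induct)
  case (1 p q r ps)
  then show ?case by (cases i) auto
qed auto

text \<open>
  The pairs give the colors at even and odd depth. With period 4 and colors 0 to 3, one is the other
  shifted by 2; a tail of length 5 or 3, found by search, makes the length odd.
\<close>

lemma windows_separated_periodic:
  assumes "t = [(0, 2), (1, 3), (2, 4), (3, 0), (4, 1)] \<or> t = [(0, 4), (2, 3), (4, 1)]"
  shows "windows_separated
    (concat (replicate (Suc m) [(0, 2), (1, 3), (2, 0), (3, 1)]) @ t @ [(0, 2), (1, 3)])"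
proof (induction m)
  case 0
  then show ?case using assms by (auto simp: separated_def)
next
  case (Suc m)
  then show ?case by (simp add: separated_def)
qed

lemma five_coloring_of_prism:
  assumes "odd n" "9 \<le> n"
  obtains F :: "bool \<Rightarrow> nat \<Rightarrow> nat" where
    "\<And>b j. j < n \<Longrightarrow> F b j < 5"
    "\<And>b j. j < n \<Longrightarrow> F b j \<noteq> F b (Suc j mod n)"
    "\<And>b j. j < n \<Longrightarrow> F b j \<noteq> F b (Suc (Suc j mod n) mod n)"
    "\<And>b j. j < n \<Longrightarrow> F b j \<noteq> F (\<not> b) j"
    "\<And>b j. j < n \<Longrightarrow> F b j \<noteq> F (\<not> b) (Suc j mod n)"
proof -
  define t :: "(nat \<times> nat) list" where "t = (if n mod 4 = 1
    then [(0, 2), (1, 3), (2, 4), (3, 0), (4, 1)] else [(0, 4), (2, 3), (4, 1)])"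
  \<comment> \<open>Residue 1 takes a tail of length 5, hence one block fewer. By
    \<open>9 \<le> n\<close> at least one block remains.\<close>
  define m where "m = (if n mod 4 = 1 then n div 4 - 2 else n div 4 - 1)"
  have n: "n = 4 * Suc m + length t" unfolding t_def m_def using assms by (simp split: if_splits) presburger
  define ps where "ps = concat (replicate (Suc m) [(0, 2), (1, 3), (2, 0), (3, 1)]) @ t"
  have len: "length ps = n"
    unfolding ps_def n by (simp add: length_concat sum_list_replicate)
  \<comment> \<open>Repeating the first two pairs at the end covers the windows that cross the
    closing point.\<close>
  have w: "windows_separated (ps @ [(0, 2), (1, 3)])"
    unfolding ps_def using windows_separated_periodic[of t m] by (simp add: t_def)
  have start: "ps ! 0 = (0, 2)" "ps ! Suc 0 = (1, 3)" by (simp_all add: ps_def)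
  have sep: "separated (ps ! j) (ps ! (Suc j mod n)) (ps ! (Suc (Suc j mod n) mod n))"
    if j: "j < n" for j
  proof -
    have "(ps @ [(0, 2), (1, 3)]) ! i = ps ! (i mod n)" if "i < n + 2" for i
    proof (cases "i < n")
      case False
      then have "i = n \<or> i = Suc n" using that by linarith
      then show ?thesis using len start assms(2) by (auto simp: nth_append mod_Suc)
    qed (use len in \<open>simp add: nth_append\<close>)
    then show ?thesis
      using windows_separated_nth[OF w, of j] j len by (simp add: mod_Suc_eq)
  qed
  have ps: "set ps \<subseteq> {..<5} \<times> {..<5}" by (auto simp: ps_def t_def split: if_splits)
  have "ps ! j \<in> {..<5} \<times> {..<5}" if "j < n" for j
    using ps that len nth_mem[of j ps] by blast
  then have "fst (ps ! j) < 5" "snd (ps ! j) < 5" if "j < n" for j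
    using that by (simp_all add: mem_Times_iff)
  then show ?thesis
    by (intro that[of "\<lambda>b j. if b then snd (ps ! j) else fst (ps ! j)"])
      (use sep in \<open>auto simp: separated_def split: if_splits\<close>)
qed

text \<open>The edge is named by the endpoint whose cyclic successor is the other one, whichever way
  the arc points.\<close>

definition edge_index :: "nat \<Rightarrow> nat \<Rightarrow> nat \<Rightarrow> nat" where
  "edge_index n u v = (if v = Suc u mod n then u else v)"

lemma edge_index_cases:
  assumes "(u, v) \<in> parcs (cycle_graph n)"
  shows "edge_index n u v = u \<or> u = Suc (edge_index n u v) mod n"
  using assms by (auto simp: edge_index_def cycle_graph_def)

lemma Suc_mod_inj: "u < n \<Longrightarrow> v < n \<Longrightarrow> Suc u mod n = Suc v mod n \<Longrightarrow> u = v"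
  by (auto simp: mod_Suc split: if_splits)

lemma edge_index_commute:
  assumes "3 \<le> n" "(u, v) \<in> parcs (cycle_graph n)"
  shows "edge_index n u v = edge_index n v u"
proof -
  have "u < n" "v < n" using assms by (auto simp: cycle_graph_def)
  then have "\<not> (v = Suc u mod n \<and> u = Suc v mod n)"
    using assms(1) by (simp add: mod_Suc)
  then show ?thesis using assms(2) by (auto simp: edge_index_def cycle_graph_def)
qed

lemma edge_index_less: "(u, v) \<in> parcs (cycle_graph n) \<Longrightarrow> edge_index n u v < n"
  by (auto simp: edge_index_def cycle_graph_def)

lemma edge_eq_edge_index:
  "(u, v) \<in> parcs (cycle_graph n) \<Longrightarrow> {u, v} = {edge_index n u v, Suc (edge_index n u v) mod n}"
  by (auto simp: edge_index_def cycle_graph_def)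

lemma edge_index_same:
  assumes "(u, v) \<in> parcs (cycle_graph n)" "(u, v') \<in> parcs (cycle_graph n)"
    and "j = edge_index n u v" "j' = edge_index n u v'"
  shows "j = j' \<or> j' = Suc j mod n \<or> j = Suc j' mod n"
  using edge_index_cases[OF assms(1)] edge_index_cases[OF assms(2)] Suc_mod_inj[of j n j']
    edge_index_less[OF assms(1)] edge_index_less[OF assms(2)] assms(3,4) by auto

lemma edge_index_adjacent:
  assumes "(u, v) \<in> parcs (cycle_graph n)" "(u', v') \<in> parcs (cycle_graph n)"
    and "(u, u') \<in> parcs (cycle_graph n)"
    and "j = edge_index n u v" "j' = edge_index n u' v'"
  shows "j = j' \<or> j' = Suc j mod n \<or> j = Suc j' mod n \<or>
    j' = Suc (Suc j mod n) mod n \<or> j = Suc (Suc j' mod n) mod n"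
proof -
  have less: "j < n" "j' < n" "u < n" "u' < n"
    using edge_index_less assms by (auto simp: cycle_graph_def)
  have "j = u \<or> u = Suc j mod n" "j' = u' \<or> u' = Suc j' mod n"
    using edge_index_cases[OF assms(1)] edge_index_cases[OF assms(2)] assms(4,5) by auto
  moreover have "u' = Suc u mod n \<or> u = Suc u' mod n"
    using assms(3) by (auto simp: cycle_graph_def)
  ultimately show ?thesis using less Suc_mod_inj by metis
qed

section \<open>Assembling the coloring of the product\<close>

text \<open>The summands cut \<open>D\<close> greedily into pieces of size at most \<open>l\<close>;
  truncated subtraction makes them 0 once \<open>D\<close> is used up.\<close>

lemma sum_min_diff: "(\<Sum>g<k. min l (D - g * l)) = min D (k * l)" for D l k :: nat
proof (induction k)
  case (Suc k)
  then show ?case by (simp add: min_def) linarith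
qed simp

theorem theorem12:
  fixes T :: "'a pair_pre_digraph" and l :: nat
  assumes "tree_graph T" and "l > 3"
  shows "int (strong_chromatic_index (T \<box> cycle_graph (2 * l + 1)))
           \<le> 2 * int (max_degree T) + \<lceil>real (max_degree T) / real l\<rceil> + 5"
proof -
  interpret T: pair_graph T using assms(1) by (simp add: tree_graph_def)
  define n where "n = 2 * l + 1"
  define D where "D = max_degree T"
  define k where "k = nat \<lceil>real D / real l\<rceil>"
  define L where "L g = min l (D - g * l)" for g
  have "real D / real l \<le> real k" unfolding k_def by linarith
  then have "real D \<le> real (k * l)" using assms(2) by (simp add: field_simps)
  then have "D \<le> k * l" by (simp only: of_nat_le_iff)
  then have sumL: "(\<Sum>g<k. L g) = D" unfolding L_def sum_min_diff by simp
  have Ll: "L g \<le> l" for g by (simp add: L_def)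

  \<comment> \<open>Slot \<open>(g, f)\<close> is strand \<open>f\<close> of part \<open>g\<close>; states consist of the parity of the depth and a star
    for every part.\<close>
  define K where "K = (SIGMA g:{..<k}. {1..int (L g)})"
  define V where "V = (\<lambda>(b :: bool, S). \<forall>g. valid_star (int (L g)) (S g))"
  define rsv where "rsv = (\<lambda>(b :: bool, S :: nat \<Rightarrow> star).
    {(g, parent_strand (S g)) | g. 1 \<le> parent_strand (S g)})"
  define col where "col S \<kappa> i =
      (fst \<kappa>, strand_color (int (L (fst \<kappa>))) (S (fst \<kappa>)) (snd \<kappa>) (position (L (fst \<kappa>)) i))"
    for S :: "nat \<Rightarrow> star" and \<kappa> i
  define pal where "pal S i = (SIGMA g:{..<k}. star_colors (int (L g)) (S g) (position (L g) i))"
    for S :: "nat \<Rightarrow> star" and i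
  \<comment> \<open>The two ends of a tree edge agree on its color at every level, and their
    palettes share no other color. This excludes conflicts between edges joined by a tree
    edge.\<close>
  define R where "R s \<kappa> s' \<kappa>' \<longleftrightarrow> fst s' = (\<not> fst s) \<and> (\<forall>i. col (snd s) \<kappa> i = col (snd s') \<kappa>' i \<and>
      pal (snd s) i \<inter> pal (snd s') i \<subseteq> {col (snd s) \<kappa> i})"
    for s :: "bool \<times> (nat \<Rightarrow> star)" and \<kappa> s' \<kappa>'

  have finK: "finite K" by (simp add: K_def)
  have cardK: "card K = D" unfolding K_def by (simp add: sumL)
  have deg: "max_degree T \<le> card K" using cardK by (simp add: D_def)
  have init: "V (False, \<lambda>g. (0, 0, \<lambda>p. p))" "rsv (False, \<lambda>g. (0, 0, \<lambda>p. p)) = {}"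
    by (auto simp: V_def rsv_def)
  have step: "\<exists>s' \<kappa>'. V s' \<and> \<kappa>' \<in> K \<and> rsv s' \<subseteq> {\<kappa>'} \<and> R s \<kappa> s' \<kappa>'"
    if V: "V s" and \<kappa>: "\<kappa> \<in> K" "\<kappa> \<notin> rsv s" for s \<kappa>
  proof -
    obtain b S g f where s: "s = (b, S)" "\<kappa> = (g, f)" by (metis surj_pair)
    let ?r = "int (L g)"
    have g: "g < k" "1 \<le> f" "f \<le> ?r" using \<kappa>(1) s by (auto simp: K_def)
    have val: "valid_star (int (L h)) (S h)" for h using V s by (simp add: V_def)
    have f: "f \<noteq> parent_strand (S g)" using \<kappa>(2) s g by (auto simp: rsv_def)
    define S' where "S' h = (if h = g then cross_star ?r (S g) f else shift_star (int (L h)) (S h))" for h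
    define f' where "f' = parent_strand (S' g)"
    note cr = valid_star_cross[OF val g(2,3) f]
    have "V (\<not> b, S')" using cr(1) valid_star_shift(1)[OF val] by (simp add: V_def S'_def)
    moreover have "(g, f') \<in> K" using cr g by (simp add: K_def f'_def S'_def)
    moreover have "rsv (\<not> b, S') \<subseteq> {(g, f')}"
      using valid_star_shift(2)[OF val] by (auto simp: rsv_def f'_def S'_def split: if_splits)
    moreover have "R (b, S) (g, f) (\<not> b, S') (g, f')"
    proof -
      have "col S (g, f) i = col S' (g, f') i" for i
        using strand_color_cross[OF val g(2,3) f position_range] by (simp add: col_def f'_def S'_def)
      moreover have "pal S i \<inter> pal S' i \<subseteq> {col S (g, f) i}" for i
      proof
        fix x assume x: "x \<in> pal S i \<inter> pal S' i"
        then obtain h c where h: "x = (h, c)" "c \<in> star_colors (int (L h)) (S h) (position (L h) i)"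
          "c \<in> star_colors (int (L h)) (S' h) (position (L h) i)" by (auto simp: pal_def)
        then have "h = g"
          using star_colors_shift[OF val position_range, of h i] by (auto simp: S'_def split: if_splits)
        then show "x \<in> {col S (g, f) i}"
          using h star_colors_cross[OF val g(2,3) f position_range, of i] by (auto simp: S'_def col_def)
      qed
      ultimately show ?thesis by (simp add: R_def)
    qed
    ultimately show ?thesis using s by blast
  qed
  have sym: "R s' \<kappa>' s \<kappa>" if "R s \<kappa> s' \<kappa>'" for s \<kappa> s' \<kappa>'
    using that unfolding R_def by (metis Int_commute)
  have "\<exists>st sl. (\<forall>v\<in>pverts T. V (st v) \<and> inj_on (sl v) (neighbors T v)) \<and>
      (\<forall>v w. (v, w) \<in> parcs T \<longrightarrow> sl v w \<in> K \<and> R (st v) (sl v w) (st w) (sl w v))"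
    by (rule tree_labelling[where rsv = rsv, OF assms(1) finK deg init step sym])
  then obtain st sl where VI: "\<forall>v\<in>pverts T. V (st v) \<and> inj_on (sl v) (neighbors T v)"
    and KR: "\<forall>v w. (v, w) \<in> parcs T \<longrightarrow> sl v w \<in> K \<and> R (st v) (sl v w) (st w) (sl w v)"
    by (elim exE conjE)
  have V: "V (st v)" and inj: "inj_on (sl v) (neighbors T v)" if "v \<in> pverts T" for v
    using VI that by blast+
  have slK: "sl v w \<in> K" and R: "R (st v) (sl v w) (st w) (sl w v)" if "(v, w) \<in> parcs T" for v w
    using KR that by blast+

  have n: "odd n" "9 \<le> n" "3 \<le> n" using assms(2) by (auto simp: n_def)
  obtain F :: "bool \<Rightarrow> nat \<Rightarrow> nat" where
    F: "\<And>b j. j < n \<Longrightarrow> F b j < 5"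
    "\<And>b j. j < n \<Longrightarrow> F b j \<noteq> F b (Suc j mod n)"
    "\<And>b j. j < n \<Longrightarrow> F b j \<noteq> F b (Suc (Suc j mod n) mod n)"
    "\<And>b j. j < n \<Longrightarrow> F b j \<noteq> F (\<not> b) j"
    "\<And>b j. j < n \<Longrightarrow> F b j \<noteq> F (\<not> b) (Suc j mod n)"
    using five_coloring_of_prism[OF n(1,2)] by blast

  define treecol where "treecol a b u = col (snd (st a)) (sl a b) u" for a b u
  define cyccol where "cyccol a u v = F (fst (st a)) (edge_index n u v)" for a u v
  \<comment> \<open>The sum type keeps tree colors and cycle colors apart.\<close>
  define C :: "'a \<times> nat \<Rightarrow> 'a \<times> nat \<Rightarrow> nat \<times> int + nat" where
    "C x y = (if fst x = fst y then Inr (cyccol (fst x) (snd x) (snd y))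
       else Inl (treecol (fst x) (fst y) (snd x)))" for x y
  define P :: "(nat \<times> int + nat) set" where
    "P = (SIGMA g:{..<k}. {0..2 * int (L g)}) <+> {..<5}"

  have val: "valid_star (int (L g)) (snd (st a) g)" if "a \<in> pverts T" for a g
    using V[OF that] by (simp add: V_def split: prod.splits)
  have tree_pal: "treecol a b u \<in> pal (snd (st a)) u" if ab: "(a, b) \<in> parcs T" for a b u
  proof -
    obtain g f where gf: "sl a b = (g, f)" by (metis surj_pair)
    have "g < k" "1 \<le> f" "f \<le> int (L g)" using slK[OF ab] gf by (auto simp: K_def)
    moreover from this have "strand_color (int (L g)) (snd (st a) g) f (position (L g) u)
        \<in> star_colors (int (L g)) (snd (st a) g) (position (L g) u)"
      using strand_color_in_star_colors[OF val _ _ position_range] T.wellformed'[OF ab] by simp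
    ultimately show ?thesis by (simp add: treecol_def col_def pal_def gf)
  qed
  have tree_sym: "treecol a b u = treecol b a u" if "(a, b) \<in> parcs T" for a b u
    using R[OF that] by (simp add: R_def treecol_def)
  have tree_star: "b = b'"
    if ab: "(a, b) \<in> parcs T" "(a, b') \<in> parcs T" "treecol a b u = treecol a b' u" for a b b' u
  proof -
    obtain g f g' f' where gf: "sl a b = (g, f)" "sl a b' = (g', f')" by (metis surj_pair)
    have eq: "g' = g" "strand_color (int (L g)) (snd (st a) g) f (position (L g) u)
        = strand_color (int (L g)) (snd (st a) g) f' (position (L g) u)"
      using ab(3) gf by (auto simp: treecol_def col_def)
    have "1 \<le> f" "f \<le> int (L g)" "1 \<le> f'" "f' \<le> int (L g)"
      using slK[OF ab(1)] slK[OF ab(2)] gf eq(1) by (auto simp: K_def)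
    then have "f = f'"
      using strand_color_inj[OF val _ _ _ _ position_range eq(2)] T.wellformed'[OF ab(1)] by blast
    then have "sl a b = sl a b'" using gf eq by simp
    then show ?thesis using inj[of a] ab T.wellformed'[OF ab(1)] by (auto simp: neighbors_def dest: inj_onD)
  qed
  have pal_cyc: "pal (snd (st a)) u \<inter> pal (snd (st a)) u' = {}"
    if "a \<in> pverts T" "(u, u') \<in> parcs (cycle_graph n)" for a u u'
    using star_colors_disjoint[OF val[OF that(1)] position_range position_range
        position_adjacent[OF Ll that(2)[unfolded n_def]]]
    by (auto simp: pal_def)
  have pal_tree: "pal (snd (st a)) u \<inter> pal (snd (st b)) u \<subseteq> {treecol a b u}"
    if "(a, b) \<in> parcs T" for a b u
    using R[OF that] unfolding R_def treecol_def by blast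
  have parity: "fst (st b) = (\<not> fst (st a))" if "(a, b) \<in> parcs T" for a b
    using R[OF that] by (simp add: R_def)

  let ?G = "T \<box> cycle_graph n"
  have G: "pair_graph ?G"
    using pair_graph_cartesian_product pair_graph_cycle_graph n T.pair_graph by blast
  have arcs: "((a, u), (b, v)) \<in> parcs ?G \<longleftrightarrow>
      a \<in> pverts T \<and> a = b \<and> (u, v) \<in> parcs (cycle_graph n) \<or>
      u < n \<and> u = v \<and> (a, b) \<in> parcs T" for a u b v
    by (auto simp: cartesian_product_def cycle_graph_def)
  have C_cyc: "C (a, u) (a, v) = Inr (cyccol a u v)" for a u v by (simp add: C_def)
  have C_tree: "C (a, u) (b, u) = Inl (treecol a b u)" if "(a, b) \<in> parcs T" for a b u
    using T.no_loops'[OF that] by (simp add: C_def)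
  have cyc_sep: "{u, v} = {u', v'}"
    if a: "(u, v) \<in> parcs (cycle_graph n)" "(u', v') \<in> parcs (cycle_graph n)"
      "cyccol a u v = cyccol a u' v'" "u = u' \<or> (u, u') \<in> parcs (cycle_graph n)" for a u v u' v'
  proof -
    let ?j = "edge_index n u v" and ?j' = "edge_index n u' v'"
    have j: "?j < n" "?j' < n" using edge_index_less a by auto
    have "?j = ?j' \<or> ?j' = Suc ?j mod n \<or> ?j = Suc ?j' mod n \<or>
        ?j' = Suc (Suc ?j mod n) mod n \<or> ?j = Suc (Suc ?j' mod n) mod n"
      using edge_index_same[of u v n v'] edge_index_adjacent[of u v n u' v'] a by blast
    then have "?j = ?j'" using a(3) F(2,3) j unfolding cyccol_def by metis
    then show ?thesis using edge_eq_edge_index a(1,2) by metis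
  qed
  have cyc_tree: "cyccol a u v \<noteq> cyccol b u v'"
    if a: "(u, v) \<in> parcs (cycle_graph n)" "(u, v') \<in> parcs (cycle_graph n)" "(a, b) \<in> parcs T"
    for a b u v v'
  proof -
    let ?j = "edge_index n u v" and ?j' = "edge_index n u v'"
    have j: "?j < n" "?j' < n" using edge_index_less a by auto
    have "?j = ?j' \<or> ?j' = Suc ?j mod n \<or> ?j = Suc ?j' mod n"
      using edge_index_same[of u v n v'] a by blast
    then show ?thesis using F(4,5)[OF j(1), of "fst (st a)"] F(5)[OF j(2), of "\<not> fst (st a)"] parity[OF a(3)]
      unfolding cyccol_def by auto
  qed

  have "strong_chromatic_index ?G \<le> card P"
  proof (rule strong_chromatic_index_le_card[OF G, where C = C])
    show "finite P" by (simp add: P_def)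
    fix x y assume xy: "(x, y) \<in> parcs ?G"
    obtain a u b v where [simp]: "x = (a, u)" "y = (b, v)" by (metis surj_pair)
    consider (cyc) "a \<in> pverts T" "a = b" "(u, v) \<in> parcs (cycle_graph n)"
      | (tree) "u < n" "u = v" "(a, b) \<in> parcs T" using xy arcs by auto
    note xy_cases = this
    show "C x y \<in> P"
    proof (cases rule: xy_cases)
      case cyc
      then show ?thesis using F(1) edge_index_less by (auto simp: C_cyc cyccol_def P_def)
    next
      case tree
      have "pal (snd (st a)) u \<subseteq> (SIGMA g:{..<k}. {0..2 * int (L g)})"
        unfolding pal_def using T.wellformed'[OF tree(3)] by (intro Sigma_mono order_refl star_colors_range val) simp
      then have "treecol a b u \<in> (SIGMA g:{..<k}. {0..2 * int (L g)})"
        using tree_pal[OF tree(3)] by blast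
      then show ?thesis using C_tree[OF tree(3)] tree(2) by (simp add: P_def InlI)
    qed
    show "C x y = C y x"
    proof (cases rule: xy_cases)
      case cyc
      then show ?thesis using edge_index_commute[OF n(3) cyc(3)] by (simp add: C_cyc cyccol_def)
    next
      case tree
      then show ?thesis
        using C_tree[OF tree(3)] C_tree[OF T.arcs_symmetric[OF tree(3)]] tree_sym[OF tree(3)] by simp
    qed
    fix x' y' assume xy': "(x', y') \<in> parcs ?G" and eq: "C x y = C x' y'"
      and near: "x = x' \<or> (x, x') \<in> parcs ?G"
    obtain a' u' b' v' where [simp]: "x' = (a', u')" "y' = (b', v')" by (metis surj_pair)
    consider (same) "a = a'" "u = u'" | (cyc) "a = a'" "(u, u') \<in> parcs (cycle_graph n)"
      | (tree) "u = u'" "(a, a') \<in> parcs T" using near arcs by auto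
    note near_cases = this
    consider (cyc') "a' \<in> pverts T" "a' = b'" "(u', v') \<in> parcs (cycle_graph n)"
      | (tree') "u' < n" "u' = v'" "(a', b') \<in> parcs T" using xy' arcs by auto
    then show "{x, y} = {x', y'}"
    proof cases
      case c': cyc'
      show ?thesis
      proof (cases rule: xy_cases)
        case c: cyc
        have col: "cyccol a u v = cyccol a' u' v'" using eq c c' by (simp add: C_cyc)
        show ?thesis
        proof (cases rule: near_cases)
          case tree
          then show ?thesis using cyc_tree[of u v v' a a'] c(3) c'(3) col by blast
        qed (use cyc_sep[of u v u' v' a] c c' col in \<open>auto simp: doubleton_eq_iff\<close>)
      next
        case tree
        then show ?thesis using eq c' C_tree[OF tree(3)] by (simp add: C_cyc)
      qed
    next
      case t': tree'
      show ?thesis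
      proof (cases rule: xy_cases)
        case cyc
        then show ?thesis using eq t' C_tree[OF t'(3)] by (simp add: C_cyc)
      next
        case t: tree
        have col: "treecol a b u = treecol a' b' u'"
          using eq t t' C_tree[OF t(3)] C_tree[OF t'(3)] by simp
        show ?thesis
        proof (cases rule: near_cases)
          case same
          then show ?thesis using tree_star[of a b b' u] t t' col by simp
        next
          case cyc
          then show ?thesis
            using pal_cyc[of a u u'] tree_pal[OF t(3), of u] tree_pal[OF t'(3), of u'] col
              T.wellformed'[OF t(3)] by auto
        next
          case near: tree
          \<comment> \<open>The common color lies in the palettes of both ends of the joining edge,
            so it is the color of that edge. Injectivity at each end then identifies both edges with
            it.\<close>
          have "treecol a b u \<in> pal (snd (st a)) u \<inter> pal (snd (st a')) u"
            using tree_pal[OF t(3), of u] tree_pal[OF t'(3), of u'] col near by simp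
          then have c: "treecol a b u = treecol a a' u" using pal_tree[OF near(2)] by blast
          then have "b = a'" using tree_star[OF t(3) near(2)] by simp
          moreover have "treecol a' b' u = treecol a' a u"
            using c col near tree_sym[OF near(2)] by simp
          then have "b' = a" using tree_star[OF t'(3) T.arcs_symmetric[OF near(2)]] by simp
          ultimately show ?thesis using t t' near by auto
        qed
      qed
    qed
  qed
  also have "card P = (\<Sum>g<k. 2 * L g + 1) + 5"
  proof -
    have "card {0..2 * int (L g)} = 2 * L g + 1" for g by simp
    then show ?thesis by (simp add: P_def card_Plus)
  qed
  also have "\<dots> = 2 * D + k + 5"
    unfolding sum.distrib sum_distrib_left[symmetric] sumL by simp
  finally have "int (strong_chromatic_index ?G) \<le> 2 * int D + int k + 5" by linarith
  moreover have "int k = \<lceil>real D / real l\<rceil>"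
  proof -
    have "0 \<le> real D / real l" by simp
    then have "0 \<le> \<lceil>real D / real l\<rceil>" by linarith
    then show ?thesis by (simp add: k_def)
  qed
  ultimately show ?thesis by (simp add: n_def D_def)
qed

end
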